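(* Let $n \geq 1$ and let $A$ be an $n \times n$ matrix with real entries. The following statements are equivalent: (1) $A$ is invertible. (2) $A$ is row-equivalent to the $n \times n$ identity matrix $I$. (3) The equation $Ax = b$ is feasible for every vector $b \in \mathbb{R}^n$. (4) The reduced row-echelon form of $A$ has a pivot in every row. (5) The columns of $A$ are linearly independent. (6) The equation $Ax = 0$ has only the trivial solution $x = 0$. (7) The columns of $A$ span $\mathbb{R}^n$. (8) The columns of $A$ form a basis for $\mathbb{R}^n$.
   Context: All matrices are $n \times n$ with real entries, all vectors are $n \times 1$ (elements of $\mathbb{R}^n$), and $I$ denotes the $n \times n$ identity matrix. A matrix $A$ is invertible if there is an $n \times n$ matrix $X$ with $AX = XA = I$. Two matrices are row-equivalent if one can be obtained from the other by a finite sequence of elementary row operations (interchanging two rows, multiplying a row by a nonzero scalar, adding a scalar multiple of one row to a different row). A linear system $Ax = b$ is feasible if it has at least one solution $x \in \mathbb{R}^n$. The reduced row-echelon form of $A$ is the unique matrix row-equivalent to $A$ such that: all zero rows are at the bottom; the first nonzero entry of each nonzero row (its pivot) equals $1$ and lies strictly to the right of the pivots of the rows above it; and each pivot is the only nonzero entry in its column. The columns of $A$ are linearly independent (respectively form a basis) when the list of its $n$ columns, counted with repetition, is linearly independent (respectively is a basis). *)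

theory Defs
  imports
    "Jordan_Normal_Form.Gauss_Jordan_Elimination"
    "Jordan_Normal_Form.VS_Connect"
begin

inductive elem_row_op :: "'a :: field mat \<Rightarrow> 'a mat \<Rightarrow> bool" where
  swap: "k < dim_row A \<Longrightarrow> l < dim_row A \<Longrightarrow> k \<noteq> l \<Longrightarrow> elem_row_op A (swaprows k l A)"
| mult: "k < dim_row A \<Longrightarrow> a \<noteq> 0 \<Longrightarrow> elem_row_op A (multrow k a A)"
| add: "k < dim_row A \<Longrightarrow> l < dim_row A \<Longrightarrow> k \<noteq> l \<Longrightarrow> elem_row_op A (addrow a k l A)"

text \<open>The relation is symmetric because every elementary row operation is undone by another one,
  so it does not matter which of the two matrices the operations start from.\<close>

definition row_equivalent :: "'a :: field mat \<Rightarrow> 'a mat \<Rightarrow> bool" where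
  "row_equivalent = elem_row_op\<^sup>*\<^sup>*"

text \<open>Despite its name, the library predicate \<^const>\<open>row_echelon_form\<close> describes
  \<^emph>\<open>reduced\<close> row-echelon matrices: \<^const>\<open>pivot_fun\<close> requires every pivot to be 1 and to be
  the only nonzero entry of its column. A zero row is encoded by a pivot index equal to the number
  of columns, and the monotonicity clause then forces all later rows to be zero as well.\<close>

definition rref :: "'a :: field mat \<Rightarrow> 'a mat" where
  "rref A = (THE R. row_equivalent A R \<and> row_echelon_form R)"

definition pivot_at :: "'a :: zero mat \<Rightarrow> nat \<Rightarrow> nat \<Rightarrow> bool" where
  "pivot_at R i j \<longleftrightarrow> i < dim_row R \<and> j < dim_col R \<and>
     R $$ (i, j) \<noteq> 0 \<and> (\<forall>j' < j. R $$ (i, j') = 0)"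

text \<open>The library notions of linear independence and basis concern sets. A list of vectors
  additionally has to be free of repetitions, since a repeated vector gives a nontrivial relation
  that is invisible in the underlying set.\<close>

definition (in vec_space) lin_indpt_list :: "'a vec list \<Rightarrow> bool" where
  "lin_indpt_list ws \<longleftrightarrow> set ws \<subseteq> carrier_vec n \<and> distinct ws \<and> lin_indpt (set ws)"

definition (in vec_space) basis_list :: "'a vec list \<Rightarrow> bool" where
  "basis_list ws \<longleftrightarrow> distinct ws \<and> basis (set ws)"

definition (in vec_space) spanning_list :: "'a vec list \<Rightarrow> bool" where
  "spanning_list ws \<longleftrightarrow> set ws \<subseteq> carrier_vec n \<and> span (set ws) = carrier_vec n"

definition feasible :: "'a :: field mat \<Rightarrow> 'a vec \<Rightarrow> bool" where
  "feasible A b \<longleftrightarrow> (\<exists>x \<in> carrier_vec (dim_col A). A *\<^sub>v x = b)"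

end

theory Submission
  imports Defs "Jordan_Normal_Form.Matrix_Kernel" "Jordan_Normal_Form.DL_Rank"
begin

text \<open>Every condition is compared with the single equation \<^term>\<open>rref A = 1\<^sub>m n\<close>. Two facts make this
  work. First, row operations are left multiplications by invertible matrices
  (\<open>row_equivalent_left_mult\<close>), so they preserve the kernel and turn the system \<open>A x = b\<close> into
  \<open>(P A) x = P b\<close>. Second, a square reduced row-echelon matrix that is not the identity has a zero
  last row, and therefore also a column without pivot, which yields a nonzero kernel vector. So if
  the reduced form \<open>R = P A\<close> is the identity, then \<open>P\<close> is the inverse of \<open>A\<close> and everything holds;
  otherwise \<open>R\<close> has a row without pivot and a nontrivial kernel, and \<open>R x = e\<close> has no solution for
  the last unit vector \<open>e\<close>, so everything fails.

  Since the reduced form is defined by a definite description, this presupposes that it exists and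
  is unique. Existence follows by observing that every step of Gauss-Jordan elimination is a
  sequence of elementary row operations. Uniqueness is the real work
  (\<open>row_echelon_form_eqI\<close>): a reduced row-echelon matrix can be reconstructed, column by column,
  from its kernel alone, and row-equivalent matrices have the same kernel.

  The conditions on the columns reduce to the others because \<open>A x\<close> is the linear combination of the
  columns with coefficients \<open>x\<close>: independence means a trivial kernel, spanning means solvability for
  every right-hand side, and a basis is both.\<close>

section \<open>Row operations as left multiplications\<close>

lemma elem_row_op_left_mult:
  assumes "elem_row_op A B" and "A \<in> carrier_mat nr nc"
  shows "\<exists>P \<in> carrier_mat nr nr. \<exists>Q \<in> carrier_mat nr nr. P * Q = 1\<^sub>m nr \<and> Q * P = 1\<^sub>m nr \<and> B = P * A"
  using assms
proof (cases rule: elem_row_op.cases)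
  case (swap k l)
  then have "k < nr" "l < nr" using assms(2) by auto
  then show ?thesis
    using swap swaprows_mat[OF assms(2)] swaprows_mat_inv swaprows_mat_carrier by metis
next
  case (mult k a)
  then have k: "k < nr" using assms(2) by auto
  have "multrow_mat nr k (inverse a) * multrow_mat nr k a = 1\<^sub>m nr"
    using multrow_mat_inv[OF k, of "inverse a"] mult by simp
  then show ?thesis
    using mult multrow_mat[OF assms(2)] multrow_mat_inv[OF k] multrow_mat_carrier by metis
next
  case (add k l a)
  then have k: "k < nr" "l < nr" using assms(2) by auto
  have "addrow_mat nr (- a) k l * addrow_mat nr a k l = 1\<^sub>m nr"
    using addrow_mat_inv[OF k, of "- a"] add by simp
  then show ?thesis
    using add addrow_mat[OF assms(2)] addrow_mat_inv[OF k] addrow_mat_carrier k by metis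
qed

text \<open>The inverse is recorded together with the transforming matrix, because the kernel and the
  solvable right-hand sides are transported in both directions.\<close>

lemma row_equivalent_left_mult:
  assumes "row_equivalent A B" and A: "A \<in> carrier_mat nr nc"
  obtains P Q where "P \<in> carrier_mat nr nr" "Q \<in> carrier_mat nr nr"
    "P * Q = 1\<^sub>m nr" "Q * P = 1\<^sub>m nr" "B = P * A"
proof -
  from assms(1) have "elem_row_op\<^sup>*\<^sup>* A B" unfolding row_equivalent_def .
  then have "\<exists>P \<in> carrier_mat nr nr. \<exists>Q \<in> carrier_mat nr nr. P * Q = 1\<^sub>m nr \<and> Q * P = 1\<^sub>m nr \<and> B = P * A"
  proof (induction rule: rtranclp_induct)
    case base
    show ?case
      by (intro bexI[of _ "1\<^sub>m nr"]) (use A in auto)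
  next
    case (step B C)
    then obtain P Q where PQ: "P \<in> carrier_mat nr nr" "Q \<in> carrier_mat nr nr"
      "P * Q = 1\<^sub>m nr" "Q * P = 1\<^sub>m nr" and B: "B = P * A" by blast
    have "B \<in> carrier_mat nr nc" using B PQ A by auto
    from elem_row_op_left_mult[OF step(2) this]
    obtain P' Q' where PQ': "P' \<in> carrier_mat nr nr" "Q' \<in> carrier_mat nr nr"
      "P' * Q' = 1\<^sub>m nr" "Q' * P' = 1\<^sub>m nr" and C: "C = P' * B" by blast
    have inv: "(X * Y) * (Y' * X') = 1\<^sub>m nr"
      if "X \<in> carrier_mat nr nr" "Y \<in> carrier_mat nr nr" "X' \<in> carrier_mat nr nr"
        "Y' \<in> carrier_mat nr nr" "X * X' = 1\<^sub>m nr" "Y * Y' = 1\<^sub>m nr" for X Y X' Y' :: "'a mat"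
    proof -
      have "(X * Y) * (Y' * X') = X * (Y * (Y' * X'))"
        by (rule assoc_mult_mat) (use that in auto)
      also have "Y * (Y' * X') = (Y * Y') * X'"
        by (rule assoc_mult_mat[symmetric]) (use that in auto)
      finally show ?thesis using that by simp
    qed
    have "(P' * P) * (Q * Q') = 1\<^sub>m nr" "(Q * Q') * (P' * P) = 1\<^sub>m nr"
      using inv[of P' P Q' Q] inv[of Q Q' P P'] PQ PQ' by auto
    moreover have "C = (P' * P) * A"
      unfolding C B by (rule assoc_mult_mat[symmetric]) (use PQ PQ' A in auto)
    ultimately show ?case
      by (intro bexI[of _ "P' * P"] bexI[of _ "Q * Q'"]) (use PQ PQ' in auto)
  qed
  then show thesis using that by blast
qed

lemma row_equivalent_carrier:
  assumes "row_equivalent A B" and "A \<in> carrier_mat nr nc"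
  shows "B \<in> carrier_mat nr nc"
  using row_equivalent_left_mult[OF assms] assms(2) by (metis mult_carrier_mat)

lemma row_equivalent_mat_kernel:
  assumes "row_equivalent A B" and A: "A \<in> carrier_mat nr nc"
  shows "mat_kernel B = mat_kernel A"
proof -
  obtain P Q where "P \<in> carrier_mat nr nr" "Q \<in> carrier_mat nr nr"
    "P * Q = 1\<^sub>m nr" "Q * P = 1\<^sub>m nr" "B = P * A"
    by (rule row_equivalent_left_mult[OF assms])
  then show ?thesis using mat_kernel_mult_eq[OF A, of P Q] by simp
qed

section \<open>Gauss-Jordan elimination uses only elementary row operations\<close>

text \<open>Each list entry prescribes the addition of a multiple of row \<open>i\<close> to another row. The side
  condition on the list is what makes every such step an elementary operation.\<close>

lemma row_equivalent_eliminate_entries_rec: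
  assumes "i < dim_row A" and "\<And>a i'. (a, i') \<in> set as \<Longrightarrow> i' < dim_row A \<and> i' \<noteq> i"
  shows "row_equivalent A (eliminate_entries_rec A i as)"
  using assms
proof (induction as arbitrary: A)
  case Nil
  show ?case by (simp add: row_equivalent_def)
next
  case (Cons p as)
  obtain a i' where p: "p = (a, i')" by force
  have "elem_row_op A (addrow a i' i A)"
    by (rule elem_row_op.add) (use Cons.prems p in auto)
  moreover have "row_equivalent (addrow a i' i A) (eliminate_entries_rec (addrow a i' i A) i as)"
    by (rule Cons.IH) (use Cons.prems in auto)
  ultimately show ?case unfolding p row_equivalent_def by simp
qed

lemma row_equivalent_eliminate_entries:
  assumes "i < dim_row A" and "j < dim_col A"
  shows "row_equivalent A (eliminate_entries (\<lambda>i. A $$ (i, j)) A i j)"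
  unfolding eliminate_entries_convert[OF assms(2,1) refl]
  by (rule row_equivalent_eliminate_entries_rec) (use assms in auto)

text \<open>The invertible transformation that the elimination is known to realise is not enough for
  row-equivalence, which asks for elementary steps. Hence the recursion is followed directly: each
  branch either moves on to the next column or performs a swap, a scaling of the pivot row, or the
  clearing of a column.\<close>

lemma row_equivalent_gauss_jordan_main:
  "row_equivalent A (fst (gauss_jordan_main A B i j))"
proof (induction A B i j rule: gauss_jordan_main.induct)
  case (1 A B i j)
  note IH = 1[OF refl refl]
  note unfold = gauss_jordan_main.simps[of A B i j] Let_def
  show ?case
  proof (cases "i < dim_row A \<and> j < dim_col A")
    case False
    then show ?thesis unfolding unfold row_equivalent_def by auto
  next
    case True
    note IH = IH[OF True refl]
    have step: "row_equivalent A D" if "elem_row_op A C" "row_equivalent C D" for C D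
      using that unfolding row_equivalent_def by (rule converse_rtranclp_into_rtranclp)
    consider (zero) "A $$ (i,j) = 0" | (one) "A $$ (i,j) = 1"
      | (other) "A $$ (i,j) \<noteq> 0" "A $$ (i,j) \<noteq> 1" by blast
    then show ?thesis
    proof cases
      case zero
      let ?is = "[i'. i' <- [Suc i ..< dim_row A], A $$ (i',j) \<noteq> 0]"
      show ?thesis
      proof (cases ?is)
        case Nil
        from IH(1)[OF zero Nil] show ?thesis unfolding unfold Nil using True zero by simp
      next
        case (Cons i' is')
        then have "i' \<in> set ?is" by auto
        then have "elem_row_op A (swaprows i i' A)"
          by (intro elem_row_op.swap) (use True in auto)
        from step[OF this IH(2)[OF zero Cons]] show ?thesis
          unfolding unfold Cons using True zero by simp
      qed
    next
      case one
      then have nz: "A $$ (i,j) \<noteq> 0" by simp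
      have "row_equivalent A (eliminate_entries (\<lambda>i. A $$ (i, j)) A i j)"
        by (rule row_equivalent_eliminate_entries) (use True in auto)
      with IH(3)[OF nz one refl] show ?thesis
        unfolding unfold row_equivalent_def using True one by auto
    next
      case other
      have "elem_row_op A (multrow i (inverse (A $$ (i,j))) A)"
        by (rule elem_row_op.mult) (use True other in auto)
      from step[OF this IH(4)[OF other refl]] show ?thesis
        unfolding unfold using True other by simp
    qed
  qed
qed

lemma row_equivalent_gauss_jordan_single: "row_equivalent A (gauss_jordan_single A)"
  unfolding gauss_jordan_single_def gauss_jordan_def by (rule row_equivalent_gauss_jordan_main)

section \<open>A reduced row-echelon matrix is determined by its kernel\<close>

lemma mult_mat_vec_leading:
  assumes "R \<in> carrier_mat nr nc" and "x \<in> carrier_vec nc" and "i < nr" and "j < nc"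
    and "\<And>k. j < k \<Longrightarrow> k < nc \<Longrightarrow> x $ k = 0"
  shows "(R *\<^sub>v x) $ i = (\<Sum>k<j. R $$ (i,k) * x $ k) + R $$ (i,j) * x $ j"
proof -
  have "(R *\<^sub>v x) $ i = (\<Sum>k\<in>{0..<nc}. R $$ (i,k) * x $ k)"
    using assms by (auto simp: scalar_prod_def intro!: sum.cong)
  also have "\<dots> = (\<Sum>k<Suc j. R $$ (i,k) * x $ k)"
    by (rule sum.mono_neutral_right) (use assms in auto)
  finally show ?thesis by simp
qed

text \<open>In the row of the pivot, all entries left of the pivot vanish, and to its right the vector
  vanishes, so the product in this row is just the entry of the vector at the pivot column.
  Together with the next lemma this shows that the kernel knows which columns carry a pivot: exactly
  those at which no kernel vector has its last nonzero entry.\<close>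

lemma kernel_vec_zero_at_pivot:
  assumes R: "R \<in> carrier_mat nr nc" and p: "pivot_fun R f nc" and r: "r < nr" "f r < nc"
    and x: "x \<in> mat_kernel R" and "\<And>k. f r < k \<Longrightarrow> k < nc \<Longrightarrow> x $ k = 0"
  shows "x $ f r = 0"
proof -
  from R have d: "dim_row R = nr" by simp
  note piv = pivot_funD[OF d p]
  have "0 = (R *\<^sub>v x) $ r" using mat_kernelD[OF R x] r by simp
  also have "\<dots> = (\<Sum>k<f r. R $$ (r,k) * x $ k) + R $$ (r,f r) * x $ f r"
    by (rule mult_mat_vec_leading[OF R _ r]) (use assms mat_kernelD[OF R x] in auto)
  also have "(\<Sum>k<f r. R $$ (r,k) * x $ k) = 0"
    using piv(2)[OF r(1)] by (intro sum.neutral) auto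
  finally show ?thesis using piv(4)[OF r] by simp
qed

text \<open>Setting the free variable \<open>j\<close> to 1 and all other free variables to 0 determines the pivot
  variables. Those of pivots to the right of column \<open>j\<close> become 0, because the row of such a pivot
  vanishes at \<open>j\<close>.\<close>

lemma non_pivot_kernel_vec:
  fixes R :: "'a :: field mat"
  assumes R: "R \<in> carrier_mat nr nc" and p: "pivot_fun R f nc" and j: "j < nc" "j \<notin> f ` {..<nr}"
  obtains x where "x \<in> mat_kernel R" "x $ j = 1" "\<And>k. j < k \<Longrightarrow> k < nc \<Longrightarrow> x $ k = 0"
proof -
  from R have d: "dim_row R = nr" "dim_col R = nc" by auto
  note piv = pivot_funD[OF d(1) p]
  let ?pp = "pivot_positions R"
  let ?x = "non_pivot_base R ?pp j"
  have ref: "row_echelon_form R" using p d unfolding row_echelon_form_def by auto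
  have pp: "set ?pp = {(i, f i) | i. i < nr \<and> f i \<noteq> nc}" by (rule pivot_positions(1)[OF R p])
  have nj: "j \<notin> snd ` set ?pp" unfolding pp using j by auto
  note base = non_pivot_base[OF ref R j(1) nj]
  show thesis
  proof (rule that)
    show "?x \<in> mat_kernel R" by (rule mat_kernelI[OF R base(1,3)])
    show "?x $ j = 1" by (rule base(2))
    fix k assume k: "j < k" "k < nc"
    have "R $$ (i, j) = 0" if "map_of (map prod.swap ?pp) k = Some i" for i
    proof -
      from map_of_SomeD[OF that] have "(i, k) \<in> set ?pp" by auto
      then show ?thesis using pp piv(2) k by auto
    qed
    then show "?x $ k = 0"
      using k d by (auto simp: non_pivot_base_def Let_def split: option.split)
  qed
qed

text \<open>A column with a pivot is a unit vector, so only the position of its 1 is in question. If the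
  pivot were in a lower row of \<open>D\<close> than of \<open>C\<close>, then row \<open>r\<close> of \<open>D\<close> would have its pivot in an earlier
  column, where \<open>C\<close> has a 0 in row \<open>r\<close> although the two matrices agree there.\<close>

lemma pivot_row_le:
  fixes C D :: "'a :: field mat"
  assumes C: "C \<in> carrier_mat nr nc" "pivot_fun C f nc" and D: "D \<in> carrier_mat nr nc" "pivot_fun D g nc"
    and eq: "\<And>i k. i < nr \<Longrightarrow> k < j \<Longrightarrow> C $$ (i,k) = D $$ (i,k)"
    and r: "r < nr" "f r = j" and s: "s < nr" "g s = j" and j: "j < nc"
  shows "s \<le> r"
proof (rule ccontr)
  assume "\<not> s \<le> r"
  then have rs: "r < s" by simp
  from C D have dC: "dim_row C = nr" and dD: "dim_row D = nr" by auto
  have "g r < j" using pivot_bound[OF dD D(2), of r "s - r"] rs s j by auto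
  then have "D $$ (r, g r) = 1" "C $$ (r, g r) = 0"
    using pivot_funD(4)[OF dD D(2) r(1)] pivot_funD(2)[OF dC C(2) r(1)] r j by auto
  then show False using eq[OF r(1) \<open>g r < j\<close>] by simp
qed

text \<open>Induction over the columns. A kernel vector ending at \<open>j\<close> with entry 1 expresses column \<open>j\<close>
  through the earlier ones, in the same way for both matrices; without such a vector, column \<open>j\<close> is
  a pivot column of both.\<close>

lemma row_echelon_form_eqI:
  fixes C D :: "'a :: field mat"
  assumes C: "C \<in> carrier_mat nr nc" "row_echelon_form C"
    and D: "D \<in> carrier_mat nr nc" "row_echelon_form D"
    and ker: "mat_kernel C = mat_kernel D"
  shows "C = D"
proof -
  obtain f where f: "pivot_fun C f nc" using C unfolding row_echelon_form_def by auto
  obtain g where g: "pivot_fun D g nc" using D unfolding row_echelon_form_def by auto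
  from C D have dC: "dim_row C = nr" and dD: "dim_row D = nr" by auto
  have "\<forall>i < nr. C $$ (i,j) = D $$ (i,j)" if "j < nc" for j
    using that
  proof (induction j rule: less_induct)
    case (less j)
    then have IH: "C $$ (i,k) = D $$ (i,k)" if "i < nr" "k < j" for i k
      using less.IH[OF that(2)] that less.prems by (meson less_trans)
    consider (pivot) r s where "r < nr" "f r = j" "s < nr" "g s = j"
      | (non_pivot) "j \<notin> f ` {..<nr} \<or> j \<notin> g ` {..<nr}"
      by (metis imageE lessThan_iff)
    then show ?case
    proof cases
      case pivot
      have "s \<le> r"
        by (rule pivot_row_le[OF C(1) f D(1) g IH pivot less(2)])
      moreover have "r \<le> s"
        by (rule pivot_row_le[OF D(1) g C(1) f IH[symmetric] pivot(3,4,1,2) less(2)])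
      ultimately have "r = s" by simp
      then show ?thesis
        using pivot less(2) pivot_funD(4,5)[OF dC f pivot(1)] pivot_funD(4,5)[OF dD g pivot(3)]
        by metis
    next
      case non_pivot
      \<comment> \<open>One matrix lacking a pivot suffices: its kernel vector is also one of the other matrix.\<close>
      then obtain x where x: "x \<in> mat_kernel C" "x $ j = 1"
        "\<And>k. j < k \<Longrightarrow> k < nc \<Longrightarrow> x $ k = 0"
        using non_pivot_kernel_vec[OF C(1) f less(2)] non_pivot_kernel_vec[OF D(1) g less(2)] ker
        by metis
      have entry: "R $$ (i,j) = - (\<Sum>k<j. R $$ (i,k) * x $ k)"
        if "R \<in> carrier_mat nr nc" "x \<in> mat_kernel R" "i < nr" for R i
        using mult_mat_vec_leading[OF that(1) _ that(3) less(2) x(3)] mat_kernelD[OF that(1,2)] that x(2)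
        by (simp add: eq_neg_iff_add_eq_0 add.commute)
      show ?thesis using entry[OF C(1)] entry[OF D(1)] x(1) ker IH by simp
    qed
  qed
  then show ?thesis using C D by (intro eq_matI) auto
qed

section \<open>Existence and uniqueness of the reduced row-echelon form\<close>

lemma row_equivalent_row_echelon_unique:
  fixes A :: "'a :: field mat"
  assumes "row_equivalent A C" "row_echelon_form C" "row_equivalent A D" "row_echelon_form D"
  shows "C = D"
proof -
  have A: "A \<in> carrier_mat (dim_row A) (dim_col A)" by auto
  have "mat_kernel C = mat_kernel D"
    using row_equivalent_mat_kernel[OF assms(1) A] row_equivalent_mat_kernel[OF assms(3) A] by simp
  then show ?thesis
    by (rule row_echelon_form_eqI[OF row_equivalent_carrier[OF assms(1) A] assms(2)
          row_equivalent_carrier[OF assms(3) A] assms(4)])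
qed

lemma rref_eqI:
  assumes "row_equivalent A R" and "row_echelon_form R"
  shows "rref A = R"
  unfolding rref_def
  by (rule the_equality) (use assms in \<open>auto intro: row_equivalent_row_echelon_unique[OF _ _ assms]\<close>)

lemma rref_eq_gauss_jordan_single: "rref A = gauss_jordan_single A"
proof (rule rref_eqI)
  show "row_equivalent A (gauss_jordan_single A)" by (rule row_equivalent_gauss_jordan_single)
  show "row_echelon_form (gauss_jordan_single A)"
    by (rule gauss_jordan_single(3)[OF _ refl, of A "dim_row A" "dim_col A"]) auto
qed

lemma row_equivalent_rref: "row_equivalent A (rref A)"
  unfolding rref_eq_gauss_jordan_single by (rule row_equivalent_gauss_jordan_single)

lemma row_echelon_form_rref: "row_echelon_form (rref A)"
  unfolding rref_eq_gauss_jordan_single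
  by (rule gauss_jordan_single(3)[OF _ refl, of A "dim_row A" "dim_col A"]) auto

lemma row_echelon_form_one_mat: "row_echelon_form (1\<^sub>m n)"
  unfolding row_echelon_form_def by (intro exI[of _ "\<lambda>i. i"] pivot_funI[of _ n]) auto

lemma mat_kernel_one_mat: "mat_kernel (1\<^sub>m n :: 'a :: comm_ring_1 mat) = {0\<^sub>v n}"
  unfolding mat_kernel_def by auto

section \<open>Square matrices and the reduced form being the identity\<close>

context
  fixes A :: "'a :: field mat" and n :: nat
  assumes A: "A \<in> carrier_mat n n"
begin

lemma row_equivalent_one_iff_rref: "row_equivalent A (1\<^sub>m n) \<longleftrightarrow> rref A = 1\<^sub>m n"
  using rref_eqI[OF _ row_echelon_form_one_mat] row_equivalent_rref by metis

text \<open>A square reduced form other than the identity has fewer pivots than columns, and a column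
  without pivot gives a nonzero kernel vector.\<close>

lemma trivial_kernel_iff_rref: "mat_kernel A = {0\<^sub>v n} \<longleftrightarrow> rref A = 1\<^sub>m n"
proof -
  have R: "rref A \<in> carrier_mat n n" by (rule row_equivalent_carrier[OF row_equivalent_rref A])
  have ker: "mat_kernel A = mat_kernel (rref A)"
    by (rule row_equivalent_mat_kernel[OF row_equivalent_rref A, symmetric])
  show ?thesis
  proof
    assume "mat_kernel A = {0\<^sub>v n}"
    then show "rref A = 1\<^sub>m n"
      using find_base_vector_not_1[OF row_echelon_form_rref R] mat_kernelI[OF R] ker by blast
  next
    assume "rref A = 1\<^sub>m n"
    then show "mat_kernel A = {0\<^sub>v n}" unfolding ker by (simp add: mat_kernel_one_mat)
  qed
qed

lemma pivots_iff_rref: "(\<forall>i < n. \<exists>j. pivot_at (rref A) i j) \<longleftrightarrow> rref A = 1\<^sub>m n"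
proof
  have R: "rref A \<in> carrier_mat n n" by (rule row_equivalent_carrier[OF row_equivalent_rref A])
  assume piv: "\<forall>i < n. \<exists>j. pivot_at (rref A) i j"
  show "rref A = 1\<^sub>m n"
  proof (rule ccontr)
    assume "rref A \<noteq> 1\<^sub>m n"
    with row_echelon_form_imp_1_or_0_row[OF R row_echelon_form_rref]
    have n: "n > 0" and zero: "row (rref A) (n - 1) = 0\<^sub>v n" by auto
    from n have "n - 1 < n" by simp
    with piv obtain j where j: "pivot_at (rref A) (n - 1) j" by blast
    then have "j < n" "rref A $$ (n - 1, j) \<noteq> 0" using R unfolding pivot_at_def by auto
    moreover have "rref A $$ (n - 1, j) = row (rref A) (n - 1) $ j" using R n \<open>j < n\<close> by simp
    ultimately show False using zero by simp
  qed
next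
  assume "rref A = 1\<^sub>m n"
  then show "\<forall>i < n. \<exists>j. pivot_at (rref A) i j"
    by (auto simp: pivot_at_def)
qed

text \<open>An invertible matrix has a trivial kernel. Conversely, if \<open>P\<close> transforms \<open>A\<close> into the identity,
  then \<open>A\<close> is the two-sided inverse of \<open>P\<close>.\<close>

lemma invertible_iff_rref: "invertible_mat A \<longleftrightarrow> rref A = 1\<^sub>m n"
proof
  assume "invertible_mat A"
  then obtain B where AB: "A * B = 1\<^sub>m n" and BA: "B * A = 1\<^sub>m (dim_row B)"
    using A unfolding invertible_mat_def inverts_mat_def by auto
  have "dim_col B = dim_col (1\<^sub>m n :: 'a mat)" using arg_cong[OF AB, of dim_col] by simp
  moreover have "dim_row B = n" using arg_cong[OF BA, of dim_col] A by simp
  ultimately have B: "B \<in> carrier_mat n n" by auto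
  with BA have BA: "B * A = 1\<^sub>m n" by simp
  have "mat_kernel A = mat_kernel (1\<^sub>m n)"
    using mat_kernel_mult_eq[OF A B A AB] unfolding BA by (rule sym)
  then show "rref A = 1\<^sub>m n"
    unfolding trivial_kernel_iff_rref[symmetric] mat_kernel_one_mat .
next
  assume rref: "rref A = 1\<^sub>m n"
  obtain P Q where PQ: "P \<in> carrier_mat n n" "Q \<in> carrier_mat n n"
    "P * Q = 1\<^sub>m n" "Q * P = 1\<^sub>m n" and PA: "rref A = P * A"
    by (rule row_equivalent_left_mult[OF row_equivalent_rref A])
  have "A = (Q * P) * A" using PQ A by simp
  also have "\<dots> = Q * (P * A)" by (rule assoc_mult_mat) (use PQ A in auto)
  also have "P * A = 1\<^sub>m n" using PA rref by simp
  finally have "A = Q" using PQ(2) by simp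
  then show "invertible_mat A"
    using PQ unfolding invertible_mat_def inverts_mat_def by auto
qed

text \<open>If the reduced form \<open>P A\<close> has a zero last row, no \<open>x\<close> satisfies \<open>P A x = e\<close> for the last unit
  vector \<open>e\<close>. Pulling \<open>e\<close> back along \<open>P\<close> gives a right-hand side for which \<open>A\<close> itself has no
  solution.\<close>

lemma feasible_iff_rref: "(\<forall>b \<in> carrier_vec n. feasible A b) \<longleftrightarrow> rref A = 1\<^sub>m n"
proof -
  obtain P Q where PQ: "P \<in> carrier_mat n n" "Q \<in> carrier_mat n n"
    "P * Q = 1\<^sub>m n" "Q * P = 1\<^sub>m n" and PA: "rref A = P * A"
    by (rule row_equivalent_left_mult[OF row_equivalent_rref A])
  have R: "rref A \<in> carrier_mat n n" using PA PQ A by simp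
  have PQv: "P *\<^sub>v (Q *\<^sub>v v) = v" "Q *\<^sub>v (P *\<^sub>v v) = v" if "v \<in> carrier_vec n" for v
    using PQ that assoc_mult_mat_vec[of P n n Q n v] assoc_mult_mat_vec[of Q n n P n v] by auto
  have Rx: "rref A *\<^sub>v x = P *\<^sub>v (A *\<^sub>v x)" if "x \<in> carrier_vec n" for x
    unfolding PA by (rule assoc_mult_mat_vec) (use PQ A that in auto)
  show ?thesis
  proof
    assume feas: "\<forall>b \<in> carrier_vec n. feasible A b"
    show "rref A = 1\<^sub>m n"
    proof (rule ccontr)
      assume "rref A \<noteq> 1\<^sub>m n"
      with row_echelon_form_imp_1_or_0_row[OF R row_echelon_form_rref]
      have n: "n > 0" and zero: "row (rref A) (n - 1) = 0\<^sub>v n" by auto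
      let ?e = "unit_vec n (n - 1) :: 'a vec"
      have "Q *\<^sub>v ?e \<in> carrier_vec n" using PQ by simp
      with feas obtain x where x: "x \<in> carrier_vec n" "A *\<^sub>v x = Q *\<^sub>v ?e"
        using A unfolding feasible_def by auto
      then have "rref A *\<^sub>v x = ?e" using Rx PQv by simp
      moreover have "(rref A *\<^sub>v x) $ (n - 1) = 0" using R n zero x by simp
      ultimately show False using n by simp
    qed
  next
    assume rref: "rref A = 1\<^sub>m n"
    have "A *\<^sub>v (P *\<^sub>v b) = b" if b: "b \<in> carrier_vec n" for b
    proof -
      have "P *\<^sub>v (A *\<^sub>v (P *\<^sub>v b)) = P *\<^sub>v b"
        using Rx[of "P *\<^sub>v b"] rref PQ b by simp
      then show ?thesis using PQv(2) A PQ b by (metis mult_mat_vec_carrier)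
    qed
    then show "\<forall>b \<in> carrier_vec n. feasible A b"
      using A PQ unfolding feasible_def by (metis carrier_matD(2) mult_mat_vec_carrier)
  qed
qed

section \<open>Conditions on the list of columns\<close>

lemma spanning_list_cols_iff_feasible:
  "vec_space.spanning_list n (cols A) \<longleftrightarrow> (\<forall>b \<in> carrier_vec n. feasible A b)"
proof -
  interpret vec_space "TYPE('a)" n .
  have sub: "set (cols A) \<subseteq> carrier_vec n" using A cols_dim by blast
  have span: "span (set (cols A)) = {y \<in> carrier_vec n. \<exists>x \<in> carrier_vec n. A *\<^sub>v x = y}"
    using col_space_eq[OF A] unfolding col_space_def carrier_matD[OF A] .
  then show ?thesis
    using sub unfolding spanning_list_def feasible_def carrier_matD(2)[OF A] span by blast
qed

text \<open>Two equal columns at positions \<open>i\<close> and \<open>j\<close> put the difference of the unit vectors \<open>i\<close> and \<open>j\<close>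
  into the kernel, so a trivial kernel also excludes repetitions. For distinct columns, relations
  between the columns as a set are the same as kernel vectors.\<close>

lemma lin_indpt_list_cols_iff_kernel:
  "vec_space.lin_indpt_list n (cols A) \<longleftrightarrow> mat_kernel A = {0\<^sub>v n}"
proof -
  interpret vec_space "TYPE('a)" n .
  have sub: "set (cols A) \<subseteq> carrier_vec n" using A cols_dim by blast
  have zero: "0\<^sub>v n \<in> mat_kernel A" by (rule mat_kernelI[OF A]) (use A in auto)
  have dist: "distinct (cols A)" if ker: "mat_kernel A = {0\<^sub>v n}"
  proof (rule ccontr)
    assume "\<not> distinct (cols A)"
    then obtain i j where ij: "i < n" "j < n" "i \<noteq> j" "col A i = col A j"
      using A unfolding distinct_conv_nth by auto
    let ?x = "unit_vec n i - unit_vec n j :: 'a vec"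
    have "A *\<^sub>v ?x = A *\<^sub>v unit_vec n i - A *\<^sub>v unit_vec n j"
      by (rule mult_minus_distrib_mat_vec[OF A]) auto
    also have "\<dots> = col A i - col A j"
      using ij(1,2) A by (intro eq_vecI) auto
    also have "\<dots> = 0\<^sub>v n" unfolding ij(4) using A by (intro eq_vecI) auto
    finally have "?x \<in> mat_kernel A" by (intro mat_kernelI[OF A]) auto
    then have "?x $ i = 0\<^sub>v n $ i" using ker by simp
    then show False using ij by simp
  qed
  show ?thesis
  proof
    assume "vec_space.lin_indpt_list n (cols A)"
    then have *: "distinct (cols A)" "lin_indpt (set (cols A))" unfolding lin_indpt_list_def by auto
    have "v = 0\<^sub>v n" if "v \<in> mat_kernel A" for v
      using lin_depI[OF A _ _ _ *(1), of v] *(2) mat_kernelD[OF A that] by blast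
    then show "mat_kernel A = {0\<^sub>v n}" using zero by blast
  next
    assume ker: "mat_kernel A = {0\<^sub>v n}"
    have "lin_indpt (set (cols A))"
    proof
      assume "lin_dep (set (cols A))"
      then obtain v where "v \<in> carrier_vec n" "v \<noteq> 0\<^sub>v n" "A *\<^sub>v v = 0\<^sub>v n"
        by (rule lin_depE[OF A _ dist[OF ker]])
      then show False using mat_kernelI[OF A] ker by simp
    qed
    then show "vec_space.lin_indpt_list n (cols A)"
      using sub dist[OF ker] unfolding lin_indpt_list_def by simp
  qed
qed

end

lemma (in vec_space) basis_list_iff:
  "basis_list ws \<longleftrightarrow> lin_indpt_list ws \<and> spanning_list ws"
  unfolding basis_list_def lin_indpt_list_def spanning_list_def basis_def by blast

section \<open>The equivalence\<close>

theorem mainTheorem3: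
  fixes A :: "real mat" and n :: nat
  assumes "n \<ge> 1" and "A \<in> carrier_mat n n"
  shows "(invertible_mat A \<longleftrightarrow> row_equivalent A (1\<^sub>m n)) \<and>
    (invertible_mat A \<longleftrightarrow> (\<forall>b \<in> carrier_vec n. feasible A b)) \<and>
    (invertible_mat A \<longleftrightarrow> (\<forall>i < n. \<exists>j. pivot_at (rref A) i j)) \<and>
    (invertible_mat A \<longleftrightarrow> vec_space.lin_indpt_list n (cols A)) \<and>
    (invertible_mat A \<longleftrightarrow> {x \<in> carrier_vec n. A *\<^sub>v x = 0\<^sub>v n} = {0\<^sub>v n}) \<and>
    (invertible_mat A \<longleftrightarrow> vec_space.spanning_list n (cols A)) \<and>
    (invertible_mat A \<longleftrightarrow> vec_space.basis_list n (cols A))"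
proof -
  note A = assms(2)
  interpret vec_space "TYPE(real)" n .
  show ?thesis
    unfolding mat_kernel[OF A, symmetric] basis_list_iff
      lin_indpt_list_cols_iff_kernel[OF A] spanning_list_cols_iff_feasible[OF A]
      feasible_iff_rref[OF A] trivial_kernel_iff_rref[OF A] pivots_iff_rref[OF A]
      row_equivalent_one_iff_rref[OF A] invertible_iff_rref[OF A]
    by simp
qed

end
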